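(* Let $F$ be a regular class of first order formulas and let $G$ be a digraph definable by a sentence in $F$. Then $$L_F(G)<\mathrm{Tower}\bigl(D_F(G)+\log^*D_F(G)+2\bigr).$$
   Context: A digraph is a finite non-empty vertex set with a binary arc relation (loops allowed). First order formulas about digraphs use variables over vertices, relations $=$ and $\mapsto$ (arc), $\forall,\exists,\vee,\wedge,\neg$, parentheses. A sentence defines $G$ if it is true on $G$ and false on every digraph not isomorphic to $G$. $L(\Phi)$ is the number of symbols of $\Phi$, and the quantifier rank $D(\Phi)$ is the maximum number of nested quantifiers. For a class $F$ of formulas, $L_F(G)$ (resp. $D_F(G)$) is the minimum of $L(\Phi)$ (resp. $D(\Phi)$) over sentences $\Phi\in F$ defining $G$. Writing $A(x_1,\dots,x_s)$ means $x_1,\dots,x_s$ are exactly the free variables of $A$. A formula $A(x_1,\dots,x_s)$ of quantifier rank $k-s$ is normal if all negations in $A$ occur only in front of atomic subformulas, $A$ contains occurrences of the variables $x_1,\dots,x_k$ only, and every sequence of nested quantifiers of $A$ has length $k-s$ and quantifies the variables $x_{s+1},\dots,x_k$ exactly in this order. A normal form of $A(x_1,\dots,x_s)$ is a normal formula with the same free variables and the same quantifier rank that is equivalent to $A$. A class $F$ is regular if (i) $F$ is closed under taking subformulas and under renaming bound variables; (ii) for each $A\in F$, $F$ contains a normal form of $A$; (iii) for every $k\ge1$ there is a set $P^k\subseteq\{\forall,\exists\}^k$ such that a normal sentence $A$ of quantifier rank $k$ belongs to $F$ iff every sequence of nested quantifiers of $A$ belongs to $P^k$. $\mathrm{Tower}(0)=1$,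 $\mathrm{Tower}(i)=2^{\mathrm{Tower}(i-1)}$; $\log^*n$ is the minimum number of iterations of $\log_2$ bringing $n$ to $1$ or below. *)

theory Defs
  imports
    Complex_Main
    "Graph_Theory.Pair_Digraph"
    "Graph_Theory.Digraph_Isomorphism"
begin

section \<open>Digraphs\<close>

text \<open>Loops are allowed, parallel arcs are not.\<close>

definition nonempty_digraph :: "'a pair_pre_digraph \<Rightarrow> bool" where
  "nonempty_digraph G \<longleftrightarrow> pair_fin_digraph G \<and> pverts G \<noteq> {}"

section \<open>First order formulas about digraphs\<close>

type_synonym var = nat

datatype quant = All_Q | Ex_Q

datatype fm =
    EqF var var
  | ArcF var var
  | Neg fm
  | Con fm fm
  | Dis fm fm
  | Qnt quant var fm

primrec fv :: "fm \<Rightarrow> var set" where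
  "fv (EqF x y) = {x, y}"
| "fv (ArcF x y) = {x, y}"
| "fv (Neg A) = fv A"
| "fv (Con A B) = fv A \<union> fv B"
| "fv (Dis A B) = fv A \<union> fv B"
| "fv (Qnt Q x A) = fv A - {x}"

primrec vars :: "fm \<Rightarrow> var set" where
  "vars (EqF x y) = {x, y}"
| "vars (ArcF x y) = {x, y}"
| "vars (Neg A) = vars A"
| "vars (Con A B) = vars A \<union> vars B"
| "vars (Dis A B) = vars A \<union> vars B"
| "vars (Qnt Q x A) = insert x (vars A)"

definition sentence :: "fm \<Rightarrow> bool" where
  "sentence A \<longleftrightarrow> fv A = {}"

primrec qrank :: "fm \<Rightarrow> nat" where
  "qrank (EqF x y) = 0"
| "qrank (ArcF x y) = 0"
| "qrank (Neg A) = qrank A"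
| "qrank (Con A B) = max (qrank A) (qrank B)"
| "qrank (Dis A B) = max (qrank A) (qrank B)"
| "qrank (Qnt Q x A) = Suc (qrank A)"

text \<open>
  The formula as a word. Every variable is a single symbol, and a conjunction or disjunction is
  enclosed in parentheses, which makes the notation unambiguous.
\<close>

datatype symbol =
    VarS var | EqS | ArcS | NegS | ConS | DisS | QntS quant | LParS | RParS

primrec symbols :: "fm \<Rightarrow> symbol list" where
  "symbols (EqF x y) = [VarS x, EqS, VarS y]"
| "symbols (ArcF x y) = [VarS x, ArcS, VarS y]"
| "symbols (Neg A) = NegS # symbols A"
| "symbols (Con A B) = LParS # symbols A @ ConS # symbols B @ [RParS]"
| "symbols (Dis A B) = LParS # symbols A @ DisS # symbols B @ [RParS]"
| "symbols (Qnt Q x A) = QntS Q # VarS x # symbols A"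

definition fm_length :: "fm \<Rightarrow> nat" where
  "fm_length A = length (symbols A)"

primrec subformulas :: "fm \<Rightarrow> fm set" where
  "subformulas (EqF x y) = {EqF x y}"
| "subformulas (ArcF x y) = {ArcF x y}"
| "subformulas (Neg A) = insert (Neg A) (subformulas A)"
| "subformulas (Con A B) = insert (Con A B) (subformulas A \<union> subformulas B)"
| "subformulas (Dis A B) = insert (Dis A B) (subformulas A \<union> subformulas B)"
| "subformulas (Qnt Q x A) = insert (Qnt Q x A) (subformulas A)"

primrec sat :: "'a pair_pre_digraph \<Rightarrow> (var \<Rightarrow> 'a) \<Rightarrow> fm \<Rightarrow> bool" where
  "sat G \<nu> (EqF x y) \<longleftrightarrow> \<nu> x = \<nu> y"
| "sat G \<nu> (ArcF x y) \<longleftrightarrow> (\<nu> x, \<nu> y) \<in> parcs G"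
| "sat G \<nu> (Neg A) \<longleftrightarrow> \<not> sat G \<nu> A"
| "sat G \<nu> (Con A B) \<longleftrightarrow> sat G \<nu> A \<and> sat G \<nu> B"
| "sat G \<nu> (Dis A B) \<longleftrightarrow> sat G \<nu> A \<or> sat G \<nu> B"
| "sat G \<nu> (Qnt Q x A) \<longleftrightarrow>
     (case Q of All_Q \<Rightarrow> \<forall>v\<in>pverts G. sat G (\<nu>(x := v)) A
              | Ex_Q \<Rightarrow> \<exists>v\<in>pverts G. sat G (\<nu>(x := v)) A)"

definition true_on :: "fm \<Rightarrow> 'a pair_pre_digraph \<Rightarrow> bool" where
  "true_on A G \<longleftrightarrow> (\<forall>\<nu>. range \<nu> \<subseteq> pverts G \<longrightarrow> sat G \<nu> A)"

text \<open>
  In the next two definitions the digraphs \<open>H\<close> have natural numbers as vertices; every finite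
  digraph is isomorphic to one of these.
\<close>

definition equivalent :: "fm \<Rightarrow> fm \<Rightarrow> bool" where
  "equivalent A B \<longleftrightarrow>
     (\<forall>(H :: nat pair_pre_digraph) \<nu>. nonempty_digraph H \<and> range \<nu> \<subseteq> pverts H \<longrightarrow>
        (sat H \<nu> A \<longleftrightarrow> sat H \<nu> B))"

definition defines_digraph :: "fm \<Rightarrow> 'a pair_pre_digraph \<Rightarrow> bool" where
  "defines_digraph A G \<longleftrightarrow>
     sentence A \<and> true_on A G \<and>
     (\<forall>H :: nat pair_pre_digraph.
        nonempty_digraph H \<and> \<not> digraph_iso (with_proj G) (with_proj H) \<longrightarrow> \<not> true_on A H)"

section \<open>Renaming of bound variables\<close>

text \<open>\<open>subst x y A\<close> replaces the free occurrences of \<open>x\<close> in \<open>A\<close> by \<open>y\<close>.\<close>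

primrec subst :: "var \<Rightarrow> var \<Rightarrow> fm \<Rightarrow> fm" where
  "subst x y (EqF u v) = EqF (if u = x then y else u) (if v = x then y else v)"
| "subst x y (ArcF u v) = ArcF (if u = x then y else u) (if v = x then y else v)"
| "subst x y (Neg A) = Neg (subst x y A)"
| "subst x y (Con A B) = Con (subst x y A) (subst x y B)"
| "subst x y (Dis A B) = Dis (subst x y A) (subst x y B)"
| "subst x y (Qnt Q z A) = (if z = x then Qnt Q z A else Qnt Q z (subst x y A))"

text \<open>
  One renaming step: somewhere in the formula a bound variable \<open>x\<close> is replaced by a variable \<open>y\<close>
  not occurring in its scope. As there are infinitely many variables, the steps generate all of
  alpha-equivalence.
\<close>

inductive rename_bound :: "fm \<Rightarrow> fm \<Rightarrow> bool" where
  rename: "y \<notin> vars A \<Longrightarrow> rename_bound (Qnt Q x A) (Qnt Q y (subst x y A))"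
| neg: "rename_bound A A' \<Longrightarrow> rename_bound (Neg A) (Neg A')"
| con1: "rename_bound A A' \<Longrightarrow> rename_bound (Con A B) (Con A' B)"
| con2: "rename_bound B B' \<Longrightarrow> rename_bound (Con A B) (Con A B')"
| dis1: "rename_bound A A' \<Longrightarrow> rename_bound (Dis A B) (Dis A' B)"
| dis2: "rename_bound B B' \<Longrightarrow> rename_bound (Dis A B) (Dis A B')"
| qnt: "rename_bound A A' \<Longrightarrow> rename_bound (Qnt Q x A) (Qnt Q x A')"

section \<open>Normal formulas and regular classes\<close>

fun is_atom :: "fm \<Rightarrow> bool" where
  "is_atom (EqF x y) = True"
| "is_atom (ArcF x y) = True"
| "is_atom _ = False"

primrec neg_atoms_only :: "fm \<Rightarrow> bool" where
  "neg_atoms_only (EqF x y) = True"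
| "neg_atoms_only (ArcF x y) = True"
| "neg_atoms_only (Neg A) = is_atom A"
| "neg_atoms_only (Con A B) = (neg_atoms_only A \<and> neg_atoms_only B)"
| "neg_atoms_only (Dis A B) = (neg_atoms_only A \<and> neg_atoms_only B)"
| "neg_atoms_only (Qnt Q x A) = neg_atoms_only A"

text \<open>
  The maximal sequences of nested quantifiers, outermost first, each quantifier with its variable.
  A quantifier-free formula has none.
\<close>

primrec nested_quants :: "fm \<Rightarrow> (quant \<times> var) list set" where
  "nested_quants (EqF x y) = {}"
| "nested_quants (ArcF x y) = {}"
| "nested_quants (Neg A) = nested_quants A"
| "nested_quants (Con A B) = nested_quants A \<union> nested_quants B"
| "nested_quants (Dis A B) = nested_quants A \<union> nested_quants B"
| "nested_quants (Qnt Q x A) =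
     (if nested_quants A = {} then {[(Q, x)]} else (#) (Q, x) ` nested_quants A)"

text \<open>
  In \<open>normal_wrt xs s A\<close> the list \<open>xs\<close> is \<open>x\<^sub>1, \<dots>, x\<^sub>k\<close>, of which the first \<open>s\<close> are the free
  variables of \<open>A\<close>.
\<close>

definition normal_wrt :: "var list \<Rightarrow> nat \<Rightarrow> fm \<Rightarrow> bool" where
  "normal_wrt xs s A \<longleftrightarrow>
     distinct xs \<and> s \<le> length xs \<and>
     fv A = set (take s xs) \<and> qrank A = length xs - s \<and>
     neg_atoms_only A \<and> vars A \<subseteq> set xs \<and>
     (\<forall>q \<in> nested_quants A. map snd q = drop s xs)"

definition normal_fm :: "fm \<Rightarrow> bool" where
  "normal_fm A \<longleftrightarrow> (\<exists>xs s. normal_wrt xs s A)"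

definition normal_form_of :: "fm \<Rightarrow> fm \<Rightarrow> bool" where
  "normal_form_of B A \<longleftrightarrow>
     normal_fm B \<and> fv B = fv A \<and> qrank B = qrank A \<and> equivalent B A"

definition regular_class :: "fm set \<Rightarrow> bool" where
  "regular_class F \<longleftrightarrow>
     (\<forall>A\<in>F. subformulas A \<subseteq> F) \<and>
     (\<forall>A\<in>F. \<forall>B. rename_bound A B \<longrightarrow> B \<in> F) \<and>
     (\<forall>A\<in>F. \<exists>B\<in>F. normal_form_of B A) \<and>
     (\<forall>k\<ge>1. \<exists>P \<subseteq> {p :: quant list. length p = k}.
        \<forall>A. sentence A \<and> normal_fm A \<and> qrank A = k \<longrightarrow>
          (A \<in> F \<longleftrightarrow> (\<forall>q \<in> nested_quants A. map fst q \<in> P)))"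

section \<open>Succinctness of definitions\<close>

definition definable_in :: "fm set \<Rightarrow> 'a pair_pre_digraph \<Rightarrow> bool" where
  "definable_in F G \<longleftrightarrow> (\<exists>A\<in>F. defines_digraph A G)"

definition def_length :: "fm set \<Rightarrow> 'a pair_pre_digraph \<Rightarrow> nat" where
  "def_length F G = (LEAST l. \<exists>A\<in>F. defines_digraph A G \<and> fm_length A = l)"

definition def_qrank :: "fm set \<Rightarrow> 'a pair_pre_digraph \<Rightarrow> nat" where
  "def_qrank F G = (LEAST d. \<exists>A\<in>F. defines_digraph A G \<and> qrank A = d)"

primrec tower :: "nat \<Rightarrow> nat" where
  "tower 0 = 1"
| "tower (Suc i) = 2 ^ tower i"

definition log_star :: "nat \<Rightarrow> nat" where
  "log_star n = (LEAST i. (log 2 ^^ i) (real n) \<le> 1)"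

end

theory Submission
  imports Defs
begin

text \<open>
  Let \<open>B\<close> be a normal form, of quantifier rank \<open>k\<close>, of a sentence in \<open>F\<close> defining \<open>G\<close>, and let \<open>S\<close>
  be the set of its quantifier words. In the Ehrenfeucht game on \<open>G\<close> and \<open>H\<close> in which Spoiler plays
  the words of \<open>S\<close>, choosing in \<open>G\<close> at \<open>\<exists>\<close> and in \<open>H\<close> at \<open>\<forall>\<close>, a win of Duplicator transfers \<open>B\<close> from
  \<open>G\<close> to \<open>H\<close>, and such a win is itself expressed by a normal formula \<open>C\<close> with words in \<open>S\<close>, a
  Hintikka formula of \<open>G\<close>. So \<open>C\<close> defines \<open>G\<close>, and it belongs to \<open>F\<close> because membership depends on
  the words only. There are at most \<open>t\<^sub>0 = 2 ^ (2 * k\<^sup>2)\<close> Hintikka formulas at the innermost level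
  and \<open>t\<^sub>n\<^sub>+\<^sub>1 = 4 ^ t\<^sub>n\<close> one level further out, so \<open>C\<close> has length at most \<open>2 * t\<^sub>k\<^sub>-\<^sub>1\<^sup>2\<close>. The final
  estimate needs \<open>k \<ge> 2\<close>; smaller ranks define no digraph, as such sentences do not notice a
  doubling of all vertices.
\<close>

section \<open>Truth in digraphs\<close>

lemma nonempty_digraph_iff:
  "nonempty_digraph G \<longleftrightarrow>
     finite (pverts G) \<and> pverts G \<noteq> {} \<and> parcs G \<subseteq> pverts G \<times> pverts G"
proof
  assume digraph_G: "nonempty_digraph G"
  then interpret pair_fin_digraph G
    by (simp add: nonempty_digraph_def)
  show "finite (pverts G) \<and> pverts G \<noteq> {} \<and> parcs G \<subseteq> pverts G \<times> pverts G"
    using digraph_G pair_finite_verts in_arcsD1 in_arcsD2 by (auto simp: nonempty_digraph_def)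
next
  assume digraph_G: "finite (pverts G) \<and> pverts G \<noteq> {} \<and> parcs G \<subseteq> pverts G \<times> pverts G"
  then have "finite (parcs G)"
    by (meson finite_SigmaI finite_subset)
  with digraph_G have "pair_fin_digraph G"
    by unfold_locales auto
  with digraph_G show "nonempty_digraph G"
    by (simp add: nonempty_digraph_def)
qed

lemma sat_cong:
  assumes "\<And>x. x \<in> fv A \<Longrightarrow> \<nu> x = \<nu>' x"
  shows "sat G \<nu> A \<longleftrightarrow> sat G \<nu>' A"
  using assms
proof (induction A arbitrary: \<nu> \<nu>')
  case (Neg A)
  have "sat G \<nu> A \<longleftrightarrow> sat G \<nu>' A"
    using Neg.prems by (intro Neg.IH) simp
  then show ?case
    by simp
next
  case (Con A B)
  have "sat G \<nu> A \<longleftrightarrow> sat G \<nu>' A" "sat G \<nu> B \<longleftrightarrow> sat G \<nu>' B"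
    using Con.prems by (intro Con.IH; simp)+
  then show ?case
    by simp
next
  case (Dis A B)
  have "sat G \<nu> A \<longleftrightarrow> sat G \<nu>' A" "sat G \<nu> B \<longleftrightarrow> sat G \<nu>' B"
    using Dis.prems by (intro Dis.IH; simp)+
  then show ?case
    by simp
next
  case (Qnt Q x A)
  have "sat G (\<nu>(x := v)) A \<longleftrightarrow> sat G (\<nu>'(x := v)) A" for v
    using Qnt.prems by (intro Qnt.IH) simp
  then show ?case
    by (cases Q) simp_all
qed simp_all

lemma true_on_sentence_iff:
  assumes "sentence A" "pverts G \<noteq> {}"
  shows "true_on A G \<longleftrightarrow> sat G \<nu> A"
proof -
  have "sat G \<nu> A \<longleftrightarrow> sat G \<nu>' A" for \<nu>'
    using assms(1) by (intro sat_cong) (simp add: sentence_def)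
  moreover obtain v where "v \<in> pverts G"
    using assms(2) by blast
  then have "range (\<lambda>_ :: var. v) \<subseteq> pverts G"
    by auto
  ultimately show ?thesis
    unfolding true_on_def by blast
qed

definition map_digraph :: "('a \<Rightarrow> 'b) \<Rightarrow> 'a pair_pre_digraph \<Rightarrow> 'b pair_pre_digraph" where
  "map_digraph f G = \<lparr>pverts = f ` pverts G, parcs = map_prod f f ` parcs G\<rparr>"

lemma map_digraph_simps [simp]:
  "pverts (map_digraph f G) = f ` pverts G"
  "parcs (map_digraph f G) = map_prod f f ` parcs G"
  by (simp_all add: map_digraph_def)

lemma nonempty_digraph_map: "nonempty_digraph G \<Longrightarrow> nonempty_digraph (map_digraph f G)"
  by (fastforce simp: nonempty_digraph_iff)

lemma sat_map_digraph:
  assumes "parcs G \<subseteq> pverts G \<times> pverts G" "inj_on f (pverts G)" "range \<nu> \<subseteq> pverts G"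
  shows "sat (map_digraph f G) (f \<circ> \<nu>) A \<longleftrightarrow> sat G \<nu> A"
  using assms(3)
proof (induction A arbitrary: \<nu>)
  case (EqF x y)
  then have "\<nu> x \<in> pverts G" "\<nu> y \<in> pverts G"
    by auto
  then show ?case
    using assms(2) by (simp add: inj_on_eq_iff)
next
  case (ArcF x y)
  then have "(\<nu> x, \<nu> y) \<in> pverts G \<times> pverts G"
    by auto
  then show ?case
    using inj_on_image_mem_iff[OF map_prod_inj_on[OF assms(2) assms(2)] _ assms(1)] by fastforce
next
  case (Qnt Q x A)
  have "sat (map_digraph f G) ((f \<circ> \<nu>)(x := f v)) A \<longleftrightarrow> sat G (\<nu>(x := v)) A"
    if "v \<in> pverts G" for v
  proof -
    have "range (\<nu>(x := v)) \<subseteq> pverts G"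
      using Qnt.prems that by auto
    from Qnt.IH[OF this] show ?thesis
      by (simp only: fun_upd_comp)
  qed
  then show ?case
    by (cases Q) (simp_all add: comp_def)
qed auto

lemma range_subset_image_iff: "range \<mu> \<subseteq> f ` A \<longleftrightarrow> (\<exists>\<nu>. range \<nu> \<subseteq> A \<and> \<mu> = f \<circ> \<nu>)"
proof
  assume "range \<mu> \<subseteq> f ` A"
  then have "\<forall>x. \<exists>a. a \<in> A \<and> \<mu> x = f a"
    by blast
  then obtain \<nu> where "\<forall>x. \<nu> x \<in> A \<and> \<mu> x = f (\<nu> x)"
    by metis
  then show "\<exists>\<nu>. range \<nu> \<subseteq> A \<and> \<mu> = f \<circ> \<nu>"
    by (intro exI[of _ \<nu>]) auto
qed auto

lemma true_on_map_digraph: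
  assumes "nonempty_digraph G" "inj_on f (pverts G)"
  shows "true_on A (map_digraph f G) \<longleftrightarrow> true_on A G"
proof -
  have "sat (map_digraph f G) (f \<circ> \<nu>) A \<longleftrightarrow> sat G \<nu> A" if "range \<nu> \<subseteq> pverts G" for \<nu>
    using assms that by (intro sat_map_digraph) (simp_all add: nonempty_digraph_iff)
  then show ?thesis
    by (auto simp: true_on_def range_subset_image_iff)
qed

lemma nonempty_digraph_nat_copy:
  assumes "nonempty_digraph (G :: 'a pair_pre_digraph)"
  obtains f :: "'a \<Rightarrow> nat" where "inj_on f (pverts G)" "nonempty_digraph (map_digraph f G)"
  using assms nonempty_digraph_map finite_imp_inj_to_nat_seg[of "pverts G"]
  by (metis nonempty_digraph_iff)

lemma equivalent_true_on:
  assumes "equivalent A B" "nonempty_digraph (G :: 'a pair_pre_digraph)"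
  shows "true_on A G \<longleftrightarrow> true_on B G"
proof -
  obtain f :: "'a \<Rightarrow> nat"
    where nat_copy: "inj_on f (pverts G)" "nonempty_digraph (map_digraph f G)"
    using nonempty_digraph_nat_copy[OF assms(2)] .
  have "true_on A (map_digraph f G) \<longleftrightarrow> true_on B (map_digraph f G)"
    using assms(1) nat_copy(2) by (auto simp: equivalent_def true_on_def)
  then show ?thesis
    using true_on_map_digraph[OF assms(2) nat_copy(1)] by simp
qed

lemma defines_digraph_strengthen:
  assumes "defines_digraph A G" "sentence B" "true_on B G"
    and "\<And>H :: nat pair_pre_digraph. nonempty_digraph H \<Longrightarrow> true_on B H \<Longrightarrow> true_on A H"
  shows "defines_digraph B G"
  using assms by (auto simp: defines_digraph_def)

lemma defines_digraph_normal_form: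
  assumes "defines_digraph A G" "normal_form_of B A" "nonempty_digraph G"
  shows "defines_digraph B G"
proof (rule defines_digraph_strengthen[OF assms(1)])
  have equiv: "equivalent B A"
    using assms(2) by (simp add: normal_form_of_def)
  show "sentence B"
    using assms(1,2) by (simp add: defines_digraph_def normal_form_of_def sentence_def)
  show "true_on B G"
    using assms(1) equivalent_true_on[OF equiv assms(3)] by (simp add: defines_digraph_def)
  show "true_on A H" if "nonempty_digraph H" "true_on B H" for H :: "nat pair_pre_digraph"
    using equivalent_true_on[OF equiv that(1)] that(2) by simp
qed

lemma defines_digraph_card:
  assumes "defines_digraph A G" "nonempty_digraph (H :: 'b pair_pre_digraph)" "true_on A H"
  shows "card (pverts H) = card (pverts G)"
proof -
  obtain f :: "'b \<Rightarrow> nat"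
    where nat_copy: "inj_on f (pverts H)" "nonempty_digraph (map_digraph f H)"
    using nonempty_digraph_nat_copy[OF assms(2)] .
  have "digraph_iso (with_proj G) (with_proj (map_digraph f H))"
    using assms nat_copy true_on_map_digraph[OF assms(2) nat_copy(1)]
    by (auto simp: defines_digraph_def)
  then obtain h where "pre_digraph.digraph_isomorphism (with_proj G) h"
    and "with_proj (map_digraph f H) = app_iso h (with_proj G)"
    by (auto simp: digraph_iso_def)
  then have "inj_on (iso_verts h) (pverts G)" "f ` pverts H = iso_verts h ` pverts G"
    by (auto simp: pre_digraph.digraph_isomorphism_def dest!: arg_cong[of _ _ verts])
  then show ?thesis
    using nat_copy(1) by (metis card_image)
qed

section \<open>Quantifier rank one\<close>

definition double_digraph :: "'a pair_pre_digraph \<Rightarrow> ('a \<times> bool) pair_pre_digraph" where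
  "double_digraph G =
     \<lparr>pverts = pverts G \<times> UNIV, parcs = {(u, v). (fst u, fst v) \<in> parcs G}\<rparr>"

lemma nonempty_digraph_double: "nonempty_digraph G \<Longrightarrow> nonempty_digraph (double_digraph G)"
  by (auto simp: nonempty_digraph_iff double_digraph_def)

lemma sat_double_digraph_qfree:
  assumes "qrank A = 0" "fv A \<subseteq> {x}" "fst (\<mu> x) = \<nu> x"
  shows "sat (double_digraph G) \<mu> A \<longleftrightarrow> sat G \<nu> A"
  using assms by (induction A) (auto simp: double_digraph_def)

lemma sat_double_digraph_rank1:
  assumes "qrank A \<le> 1" "fv A = {}"
  shows "sat (double_digraph G) \<mu> A \<longleftrightarrow> sat G \<nu> A"
  using assms
proof (induction A)
  case (Qnt Q x A)
  then have "sat (double_digraph G) (\<mu>(x := p)) A \<longleftrightarrow> sat G (\<nu>(x := fst p)) A" for p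
    by (intro sat_double_digraph_qfree[where x = x]) auto
  then show ?case
    by (cases Q) (auto simp: double_digraph_def)
qed auto

lemma defines_digraph_qrank_ge_2:
  assumes "defines_digraph A G" "nonempty_digraph G"
  shows "2 \<le> qrank A"
proof (rule ccontr)
  assume "\<not> 2 \<le> qrank A"
  have true_A: "sentence A" "true_on A G"
    using assms(1) by (simp_all add: defines_digraph_def)
  have "pverts G \<noteq> {}" "pverts (double_digraph G) \<noteq> {}"
    using assms(2) by (simp_all add: nonempty_digraph_iff double_digraph_def)
  note true_on_iff = this[THEN true_on_sentence_iff[OF true_A(1), of _ undefined]]
  have "sat (double_digraph G) undefined A \<longleftrightarrow> sat G undefined A"
    using \<open>\<not> 2 \<le> qrank A\<close> true_A(1) by (intro sat_double_digraph_rank1) (simp_all add: sentence_def)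
  then have "true_on A (double_digraph G)"
    using true_A(2) true_on_iff by simp
  then have "card (pverts (double_digraph G)) = card (pverts G)"
    using defines_digraph_card[OF assms(1) nonempty_digraph_double[OF assms(2)]] by simp
  then show False
    using assms(2) by (simp add: double_digraph_def nonempty_digraph_iff card_cartesian_product)
qed

section \<open>Iterated connectives\<close>

text \<open>Unspecified unless \<open>X\<close> is finite and non-empty.\<close>

definition connect_all :: "(fm \<Rightarrow> fm \<Rightarrow> fm) \<Rightarrow> fm set \<Rightarrow> fm" where
  "connect_all c X =
     (let As = SOME As. distinct As \<and> set As = X in foldr c (butlast As) (last As))"

lemma connect_all_foldrE:
  assumes "finite X" "X \<noteq> {}"
  obtains As A where "connect_all c X = foldr c As A" "distinct (As @ [A])" "X = set (As @ [A])"
proof -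
  define Bs where "Bs = (SOME As. distinct As \<and> set As = X)"
  have enum_X: "distinct Bs \<and> set Bs = X"
    unfolding Bs_def by (rule someI_ex) (use finite_distinct_list[OF assms(1)] in blast)
  then have snoc: "butlast Bs @ [last Bs] = Bs"
    using assms(2) by (intro append_butlast_last_id) auto
  show thesis
  proof (rule that)
    show "connect_all c X = foldr c (butlast Bs) (last Bs)"
      by (simp add: connect_all_def Bs_def Let_def)
  qed (simp_all only: snoc enum_X)
qed

lemma connect_all_induct [consumes 2, case_names member connect]:
  assumes "finite X" "X \<noteq> {}"
    and "\<And>A. A \<in> X \<Longrightarrow> P A"
    and "\<And>A B. P A \<Longrightarrow> P B \<Longrightarrow> P (c A B)"
  shows "P (connect_all c X)"
proof -
  obtain As A where foldr:
    "connect_all c X = foldr c As A" "distinct (As @ [A])" "X = set (As @ [A])"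
    using assms(1,2) by (rule connect_all_foldrE)
  then have "\<forall>B\<in>insert A (set As). P B"
    using assms(3) by auto
  then have "P (foldr c As A)"
    by (induction As) (simp_all add: assms(4))
  then show ?thesis
    by (simp only: foldr(1))
qed

lemma sat_connect_all_Con:
  assumes "finite X" "X \<noteq> {}"
  shows "sat G \<nu> (connect_all Con X) \<longleftrightarrow> (\<forall>A\<in>X. sat G \<nu> A)"
proof -
  obtain As A where "connect_all Con X = foldr Con As A" "distinct (As @ [A])" "X = set (As @ [A])"
    using assms by (rule connect_all_foldrE)
  moreover have "sat G \<nu> (foldr Con As A) \<longleftrightarrow> (\<forall>B\<in>set (As @ [A]). sat G \<nu> B)"
    by (induction As) auto
  ultimately show ?thesis
    by (simp only:)
qed

lemma sat_connect_all_Dis: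
  assumes "finite X" "X \<noteq> {}"
  shows "sat G \<nu> (connect_all Dis X) \<longleftrightarrow> (\<exists>A\<in>X. sat G \<nu> A)"
proof -
  obtain As A where "connect_all Dis X = foldr Dis As A" "distinct (As @ [A])" "X = set (As @ [A])"
    using assms by (rule connect_all_foldrE)
  moreover have "sat G \<nu> (foldr Dis As A) \<longleftrightarrow> (\<exists>B\<in>set (As @ [A]). sat G \<nu> B)"
    by (induction As) auto
  ultimately show ?thesis
    by (simp only:)
qed

lemma fm_length_simps [simp]:
  "fm_length (EqF x y) = 3"
  "fm_length (ArcF x y) = 3"
  "fm_length (Neg A) = fm_length A + 1"
  "fm_length (Con A B) = fm_length A + fm_length B + 3"
  "fm_length (Dis A B) = fm_length A + fm_length B + 3"
  "fm_length (Qnt Q x A) = fm_length A + 2"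
  by (simp_all add: fm_length_def)

lemma fm_length_connect_all:
  assumes "finite X" "X \<noteq> {}"
    and "\<And>A B. fm_length (c A B) = fm_length A + fm_length B + 3"
  shows "fm_length (connect_all c X) + 3 = (\<Sum>A\<in>X. fm_length A + 3)"
proof -
  obtain As A where "connect_all c X = foldr c As A" "distinct (As @ [A])" "X = set (As @ [A])"
    using assms(1,2) by (rule connect_all_foldrE)
  moreover have "fm_length (foldr c As A) + 3 = (\<Sum>B\<leftarrow>As @ [A]. fm_length B + 3)"
    by (induction As) (simp_all add: assms(3))
  ultimately show ?thesis
    by (simp only: sum.distinct_set_conv_list)
qed

lemma fm_length_connect_all_le:
  assumes "finite X" "X \<noteq> {}"
    and "\<And>A B. fm_length (c A B) = fm_length A + fm_length B + 3"
    and "\<And>A. A \<in> X \<Longrightarrow> fm_length A + 5 \<le> l"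
  shows "fm_length (connect_all c X) + 5 \<le> card X * l"
proof -
  have "fm_length (connect_all c X) + 5 = (\<Sum>A\<in>X. fm_length A + 3) + 2"
    using fm_length_connect_all[OF assms(1-3)] by simp
  also have "\<dots> \<le> (\<Sum>A\<in>X. fm_length A + 3) + card X * 2"
    using assms(1,2) by (simp add: Suc_leI card_gt_0_iff)
  also have "\<dots> = (\<Sum>A\<in>X. fm_length A + 5)"
    by (simp add: sum.distrib)
  also have "\<dots> \<le> card X * l"
    using sum_bounded_above[of X "\<lambda>A. fm_length A + 5" l] assms(4) by simp
  finally show ?thesis .
qed

section \<open>Sets of words\<close>

definition uniform_words :: "nat \<Rightarrow> 'a list set \<Rightarrow> bool" where
  "uniform_words n S \<longleftrightarrow> S \<noteq> {} \<and> (\<forall>w\<in>S. length w = n)"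

definition continuations :: "'a \<Rightarrow> 'a list set \<Rightarrow> 'a list set" where
  "continuations a S = {w. a # w \<in> S}"

lemma uniform_words_continuations:
  assumes "uniform_words (Suc n) S" "continuations a S \<noteq> {}"
  shows "uniform_words n (continuations a S)"
  using assms by (auto simp: uniform_words_def continuations_def)

lemma uniform_words_Suc_cases:
  assumes "uniform_words (Suc n) S"
  obtains a where "continuations a S \<noteq> {}"
proof -
  obtain w where "w \<in> S" "length w = Suc n"
    using assms by (auto simp: uniform_words_def)
  then show thesis
    using that by (cases w) (auto simp: continuations_def)
qed

section \<open>The Ehrenfeucht game with prescribed quantifier words\<close>

definition atoms :: "var set \<Rightarrow> fm set" where
  "atoms V = {A. is_atom A \<and> fv A \<subseteq> V}"

text \<open>Atoms are tested only innermost, which loses nothing because all words have the same length.\<close>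

fun duplicator_wins ::
  "var set \<Rightarrow> var list \<Rightarrow> quant list set \<Rightarrow> 'a pair_pre_digraph \<Rightarrow> (var \<Rightarrow> 'a) \<Rightarrow>
    'b pair_pre_digraph \<Rightarrow> (var \<Rightarrow> 'b) \<Rightarrow> bool"
where
  "duplicator_wins V [] S G \<nu> H \<mu> \<longleftrightarrow> (\<forall>A\<in>atoms V. sat G \<nu> A \<longleftrightarrow> sat H \<mu> A)"
| "duplicator_wins V (y # ys) S G \<nu> H \<mu> \<longleftrightarrow>
     (continuations Ex_Q S \<noteq> {} \<longrightarrow> (\<forall>v\<in>pverts G. \<exists>w\<in>pverts H.
       duplicator_wins V ys (continuations Ex_Q S) G (\<nu>(y := v)) H (\<mu>(y := w)))) \<and>
     (continuations All_Q S \<noteq> {} \<longrightarrow> (\<forall>w\<in>pverts H. \<exists>v\<in>pverts G.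
       duplicator_wins V ys (continuations All_Q S) G (\<nu>(y := v)) H (\<mu>(y := w))))"

lemma duplicator_wins_refl:
  assumes "\<And>x. x \<in> V - set ys \<Longrightarrow> \<nu> x = \<mu> x"
  shows "duplicator_wins V ys S G \<nu> G \<mu>"
  using assms
proof (induction ys arbitrary: S \<nu> \<mu>)
  case Nil
  then have "sat G \<nu> A \<longleftrightarrow> sat G \<mu> A" if "A \<in> atoms V" for A
    using that by (intro sat_cong) (auto simp: atoms_def)
  then show ?case
    by simp
next
  case (Cons y ys)
  have "duplicator_wins V ys T G (\<nu>(y := v)) G (\<mu>(y := v))" for T v
    using Cons.prems by (intro Cons.IH) auto
  then show ?case
    by auto
qed

lemma duplicator_wins_ConsE:
  assumes "duplicator_wins V (y # ys) S G \<nu> H \<mu>" "continuations Q S \<noteq> {}"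
    and "pverts G \<noteq> {}" "pverts H \<noteq> {}"
  obtains v w where "v \<in> pverts G" "w \<in> pverts H"
    "duplicator_wins V ys (continuations Q S) G (\<nu>(y := v)) H (\<mu>(y := w))"
proof -
  obtain v w where "v \<in> pverts G" "w \<in> pverts H"
    using assms(3,4) by blast
  then show thesis
    using assms(1,2) that unfolding duplicator_wins.simps by (cases Q) metis+
qed

lemma duplicator_wins_atom:
  assumes "duplicator_wins V ys S G \<nu> H \<mu>" "uniform_words (length ys) S"
    and "pverts G \<noteq> {}" "pverts H \<noteq> {}"
    and "is_atom A" "fv A \<subseteq> V - set ys"
  shows "sat G \<nu> A \<longleftrightarrow> sat H \<mu> A"
  using assms(1,2,6)
proof (induction ys arbitrary: S \<nu> \<mu>)
  case Nil
  then show ?case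
    using assms(5) by (simp add: atoms_def)
next
  case (Cons y ys)
  have uniform: "uniform_words (Suc (length ys)) S"
    using Cons.prems(2) by simp
  obtain Q where cont: "continuations Q S \<noteq> {}"
    using uniform by (rule uniform_words_Suc_cases)
  then obtain v w where "duplicator_wins V ys (continuations Q S) G (\<nu>(y := v)) H (\<mu>(y := w))"
    using duplicator_wins_ConsE[OF Cons.prems(1) _ assms(3,4)] by metis
  moreover have "uniform_words (length ys) (continuations Q S)" "fv A \<subseteq> V - set ys"
    using uniform_words_continuations[OF uniform cont] Cons.prems(3) by auto
  ultimately have "sat G (\<nu>(y := v)) A \<longleftrightarrow> sat H (\<mu>(y := w)) A"
    by (rule Cons.IH)
  moreover have "sat K (\<kappa>(y := u)) A \<longleftrightarrow> sat K \<kappa> A" for K \<kappa> and u :: 'a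
    using Cons.prems(3) by (intro sat_cong) auto
  moreover have "sat K (\<kappa>(y := u)) A \<longleftrightarrow> sat K \<kappa> A" for K \<kappa> and u :: 'b
    using Cons.prems(3) by (intro sat_cong) auto
  ultimately show ?case
    by simp
qed

definition quant_words :: "fm \<Rightarrow> quant list set" where
  "quant_words A = map fst ` nested_quants A"

definition normal_along :: "var set \<Rightarrow> var list \<Rightarrow> quant list set \<Rightarrow> fm \<Rightarrow> bool" where
  "normal_along V ys S A \<longleftrightarrow>
     distinct ys \<and> set ys \<subseteq> V \<and> fv A \<subseteq> V - set ys \<and> vars A \<subseteq> V \<and> neg_atoms_only A \<and>
     (\<forall>q \<in> nested_quants A. map snd q = ys) \<and> quant_words A \<subseteq> S"

lemma normal_along_Con_iff:
    "normal_along V ys S (Con A B) \<longleftrightarrow> normal_along V ys S A \<and> normal_along V ys S B"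
  and normal_along_Dis_iff:
    "normal_along V ys S (Dis A B) \<longleftrightarrow> normal_along V ys S A \<and> normal_along V ys S B"
  by (auto simp: normal_along_def quant_words_def)

lemma normal_along_QntE:
  assumes "normal_along V ys S (Qnt Q y A)"
  obtains zs where "ys = y # zs" "continuations Q S \<noteq> {}" "normal_along V zs (continuations Q S) A"
proof -
  have words: "map snd q = ys" "map fst q \<in> S" if "q \<in> nested_quants (Qnt Q y A)" for q
    using assms that unfolding normal_along_def quant_words_def by blast+
  obtain q where prefix: "(Q, y) # q \<in> nested_quants (Qnt Q y A)"
    by (cases "nested_quants A = {}") auto
  define zs where "zs = map snd q"
  have ys_eq: "ys = y # zs"
    using words(1)[OF prefix] by (simp add: zs_def)
  have "map snd p = zs" "map fst p \<in> continuations Q S" if "p \<in> nested_quants A" for p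
  proof -
    have "(Q, y) # p \<in> nested_quants (Qnt Q y A)"
      using that by auto
    from words[OF this] show "map snd p = zs" "map fst p \<in> continuations Q S"
      using ys_eq by (simp_all add: continuations_def)
  qed
  then have "normal_along V zs (continuations Q S) A"
    using assms ys_eq by (auto simp: normal_along_def quant_words_def)
  moreover have "continuations Q S \<noteq> {}"
    using words(2)[OF prefix] by (auto simp: continuations_def)
  ultimately show thesis
    using that ys_eq by blast
qed

lemma duplicator_wins_transfer:
  assumes "duplicator_wins V ys S G \<nu> H \<mu>" "uniform_words (length ys) S"
    and "pverts G \<noteq> {}" "pverts H \<noteq> {}"
    and "normal_along V ys S A" "sat G \<nu> A"
  shows "sat H \<mu> A"
  using assms(1,2,5,6)
proof (induction A arbitrary: ys S \<nu> \<mu>)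
  case (EqF x y)
  then show ?case
    using duplicator_wins_atom[OF EqF.prems(1,2) assms(3,4), of "EqF x y"]
    by (auto simp: normal_along_def)
next
  case (ArcF x y)
  then show ?case
    using duplicator_wins_atom[OF ArcF.prems(1,2) assms(3,4), of "ArcF x y"]
    by (auto simp: normal_along_def)
next
  case (Neg A)
  then show ?case
    using duplicator_wins_atom[OF Neg.prems(1,2) assms(3,4), of A]
    by (auto simp: normal_along_def)
next
  case (Con A B)
  then show ?case
    by (auto simp: normal_along_Con_iff)
next
  case (Dis A B)
  then show ?case
    by (auto simp: normal_along_Dis_iff)
next
  case (Qnt Q y A)
  obtain zs where ys_eq: "ys = y # zs" and cont: "continuations Q S \<noteq> {}"
    and normal_A: "normal_along V zs (continuations Q S) A"
    using Qnt.prems(3) by (rule normal_along_QntE)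
  have "uniform_words (length zs) (continuations Q S)"
    using Qnt.prems(2) cont ys_eq by (intro uniform_words_continuations) simp_all
  then have "sat H (\<mu>(y := w)) A"
    if "duplicator_wins V zs (continuations Q S) G (\<nu>(y := v)) H (\<mu>(y := w))"
      and "sat G (\<nu>(y := v)) A" for v w
    using Qnt.IH that normal_A by blast
  then show ?case
    using Qnt.prems(1,4) ys_eq cont by (cases Q) (simp, metis)+
qed

section \<open>Hintikka formulas\<close>

lemma atoms_eq: "atoms V = case_prod EqF ` (V \<times> V) \<union> case_prod ArcF ` (V \<times> V)"
proof (rule set_eqI)
  fix A show "A \<in> atoms V \<longleftrightarrow> A \<in> case_prod EqF ` (V \<times> V) \<union> case_prod ArcF ` (V \<times> V)"
    by (cases A) (auto simp: atoms_def)
qed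

lemma finite_atoms: "finite V \<Longrightarrow> finite (atoms V)"
  by (simp add: atoms_eq)

lemma atoms_nonempty: "V \<noteq> {} \<Longrightarrow> atoms V \<noteq> {}"
  by (simp add: atoms_eq)

lemma card_atoms:
  assumes "finite V"
  shows "card (atoms V) = 2 * (card V)\<^sup>2"
proof -
  have "inj_on (case_prod EqF) (V \<times> V)" "inj_on (case_prod ArcF) (V \<times> V)"
    by (auto simp: inj_on_def)
  then have "card (case_prod EqF ` (V \<times> V)) = (card V)\<^sup>2"
    "card (case_prod ArcF ` (V \<times> V)) = (card V)\<^sup>2"
    by (simp_all only: card_image card_cartesian_product power2_eq_square)
  moreover have "case_prod EqF ` (V \<times> V) \<inter> case_prod ArcF ` (V \<times> V) = {}"
    by auto
  ultimately show ?thesis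
    using assms by (simp add: atoms_eq card_Un_disjoint)
qed

definition literals :: "fm set \<Rightarrow> fm set \<Rightarrow> fm set" where
  "literals At T = (\<lambda>A. if A \<in> T then A else Neg A) ` At"

lemma finite_literals: "finite At \<Longrightarrow> finite (literals At T)"
  by (simp add: literals_def)

lemma literals_eq_empty_iff: "literals At T = {} \<longleftrightarrow> At = {}"
  unfolding literals_def by (rule image_is_empty)

definition quant_conjuncts :: "var \<Rightarrow> quant list set \<Rightarrow> fm set \<Rightarrow> fm set \<Rightarrow> fm set" where
  "quant_conjuncts y S X Y =
     (if continuations Ex_Q S = {} then {} else Qnt Ex_Q y ` X) \<union>
     (if continuations All_Q S = {} then {} else {Qnt All_Q y (connect_all Dis Y)})"

fun hintikka_fms :: "var set \<Rightarrow> var list \<Rightarrow> quant list set \<Rightarrow> fm set" where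
  "hintikka_fms V [] S = (\<lambda>T. connect_all Con (literals (atoms V) T)) ` Pow (atoms V)"
| "hintikka_fms V (y # ys) S =
     (\<lambda>(X, Y). connect_all Con (quant_conjuncts y S X Y)) `
       ((Pow (hintikka_fms V ys (continuations Ex_Q S)) - {{}}) \<times>
        (Pow (hintikka_fms V ys (continuations All_Q S)) - {{}}))"

fun char_fm ::
  "var set \<Rightarrow> var list \<Rightarrow> quant list set \<Rightarrow> 'a pair_pre_digraph \<Rightarrow> (var \<Rightarrow> 'a) \<Rightarrow> fm"
where
  "char_fm V [] S G \<nu> = connect_all Con (literals (atoms V) {A \<in> atoms V. sat G \<nu> A})"
| "char_fm V (y # ys) S G \<nu> =
     connect_all Con (quant_conjuncts y S
       ((\<lambda>v. char_fm V ys (continuations Ex_Q S) G (\<nu>(y := v))) ` pverts G)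
       ((\<lambda>v. char_fm V ys (continuations All_Q S) G (\<nu>(y := v))) ` pverts G))"

lemma char_fm_in_hintikka_fms: "pverts G \<noteq> {} \<Longrightarrow> char_fm V ys S G \<nu> \<in> hintikka_fms V ys S"
proof (induction ys arbitrary: S \<nu>)
  case (Cons y ys)
  let ?X = "\<lambda>Q. (\<lambda>v. char_fm V ys (continuations Q S) G (\<nu>(y := v))) ` pverts G"
  have "?X Q \<in> Pow (hintikka_fms V ys (continuations Q S)) - {{}}" for Q
    using Cons by auto
  then show ?case
    by (auto intro!: image_eqI[where x = "(?X Ex_Q, ?X All_Q)"])
qed auto

lemma finite_hintikka_fms: "finite V \<Longrightarrow> finite (hintikka_fms V ys S)"
  by (induction ys arbitrary: S) (auto simp: finite_atoms)

primrec hintikka_bound :: "nat \<Rightarrow> nat \<Rightarrow> nat" where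
  "hintikka_bound k 0 = 2 ^ (2 * k\<^sup>2)"
| "hintikka_bound k (Suc n) = 4 ^ hintikka_bound k n"

lemma card_hintikka_fms:
  assumes "finite V"
  shows "card (hintikka_fms V ys S) \<le> hintikka_bound (card V) (length ys)"
proof (induction ys arbitrary: S)
  case Nil
  have "card (hintikka_fms V [] S) \<le> card (Pow (atoms V))"
    unfolding hintikka_fms.simps by (intro card_image_le) (simp add: assms finite_atoms)
  then show ?case
    by (simp add: assms finite_atoms card_Pow card_atoms)
next
  case (Cons y ys)
  let ?t = "hintikka_bound (card V) (length ys)"
  let ?P = "\<lambda>Q. Pow (hintikka_fms V ys (continuations Q S)) - {{}}"
  have finite_fms: "finite (hintikka_fms V ys T)" for T
    using assms by (rule finite_hintikka_fms)
  have card_P: "card (?P Q) \<le> 2 ^ ?t" for Q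
  proof -
    have "card (?P Q) \<le> 2 ^ card (hintikka_fms V ys (continuations Q S))"
      unfolding card_Pow[OF finite_fms, symmetric] using finite_fms by (intro card_mono) auto
    also have "\<dots> \<le> 2 ^ ?t"
      using Cons.IH by (intro power_increasing) auto
    finally show ?thesis .
  qed
  have "card (hintikka_fms V (y # ys) S) \<le> card (?P Ex_Q \<times> ?P All_Q)"
    unfolding hintikka_fms.simps by (intro card_image_le) (simp add: finite_fms)
  also have "\<dots> \<le> 2 ^ ?t * 2 ^ ?t"
    unfolding card_cartesian_product by (intro mult_le_mono card_P)
  also have "\<dots> = 4 ^ ?t"
    by (simp flip: power_mult_distrib)
  finally show ?case
    by simp
qed

lemma quant_conjuncts_finite_nonempty:
  assumes "finite X" "X \<noteq> {}" "uniform_words (Suc n) S"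
  shows "finite (quant_conjuncts y S X Y)" "quant_conjuncts y S X Y \<noteq> {}"
proof -
  obtain Q where "continuations Q S \<noteq> {}"
    using assms(3) by (rule uniform_words_Suc_cases)
  then show "quant_conjuncts y S X Y \<noteq> {}"
    using assms(2) by (cases Q) (auto simp: quant_conjuncts_def)
qed (simp add: quant_conjuncts_def assms(1))

lemma sat_quant_conjuncts:
  assumes "finite Y" "Y \<noteq> {}"
  shows "(\<forall>A\<in>quant_conjuncts y S X Y. sat H \<mu> A) \<longleftrightarrow>
    (continuations Ex_Q S \<noteq> {} \<longrightarrow> (\<forall>A\<in>X. \<exists>w\<in>pverts H. sat H (\<mu>(y := w)) A)) \<and>
    (continuations All_Q S \<noteq> {} \<longrightarrow> (\<forall>w\<in>pverts H. \<exists>A\<in>Y. sat H (\<mu>(y := w)) A))"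
  by (auto simp: quant_conjuncts_def sat_connect_all_Dis[OF assms])

lemma sat_char_fm_iff_duplicator_wins:
  assumes "pverts G \<noteq> {}" "finite V" "V \<noteq> {}" "uniform_words (length ys) S"
  shows "sat H \<mu> (char_fm V ys S G \<nu>) \<longleftrightarrow> duplicator_wins V ys S G \<nu> H \<mu>"
  using assms(4)
proof (induction ys arbitrary: S \<nu> \<mu>)
  case Nil
  have "sat H \<mu> (char_fm V [] S G \<nu>) \<longleftrightarrow>
      (\<forall>A\<in>literals (atoms V) {A \<in> atoms V. sat G \<nu> A}. sat H \<mu> A)"
    unfolding char_fm.simps using finite_atoms[OF assms(2)] atoms_nonempty[OF assms(3)]
    by (intro sat_connect_all_Con) (simp_all add: finite_literals literals_eq_empty_iff)
  also have "\<dots> \<longleftrightarrow> (\<forall>A\<in>atoms V. sat G \<nu> A \<longleftrightarrow> sat H \<mu> A)"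
    by (auto simp: literals_def simp del: if_image_distrib)
  finally show ?case
    by simp
next
  case (Cons y ys)
  let ?X = "\<lambda>Q. (\<lambda>v. char_fm V ys (continuations Q S) G (\<nu>(y := v))) ` pverts G"
  have uniform: "uniform_words (Suc (length ys)) S"
    using Cons.prems by simp
  have "?X Q \<subseteq> hintikka_fms V ys (continuations Q S)" for Q
    using char_fm_in_hintikka_fms[OF assms(1)] by blast
  then have image_X: "finite (?X Q)" "?X Q \<noteq> {}" for Q
    using finite_subset[OF _ finite_hintikka_fms[OF assms(2)]] assms(1) by (blast, simp)
  have IH: "sat H (\<mu>(y := w)) (char_fm V ys (continuations Q S) G (\<nu>(y := v))) \<longleftrightarrow>
      duplicator_wins V ys (continuations Q S) G (\<nu>(y := v)) H (\<mu>(y := w))"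
    if "continuations Q S \<noteq> {}" for Q v w
    using uniform_words_continuations[OF uniform that] by (rule Cons.IH)
  have "sat H \<mu> (char_fm V (y # ys) S G \<nu>) \<longleftrightarrow>
      (\<forall>A\<in>quant_conjuncts y S (?X Ex_Q) (?X All_Q). sat H \<mu> A)"
    unfolding char_fm.simps
    by (rule sat_connect_all_Con[OF quant_conjuncts_finite_nonempty[OF image_X uniform]])
  also have "\<dots> \<longleftrightarrow> duplicator_wins V (y # ys) S G \<nu> H \<mu>"
    unfolding sat_quant_conjuncts[OF image_X] by (simp add: IH)
  finally show ?case .
qed

lemma nested_quants_eq_empty_iff: "nested_quants A = {} \<longleftrightarrow> qrank A = 0"
  by (induction A) (auto simp: max_def)

lemma normal_along_Qnt:
  assumes "normal_along V ys (continuations Q S) A" "qrank A = length ys"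
    and "y \<in> V - set ys" "uniform_words (length ys) (continuations Q S)"
  shows "normal_along V (y # ys) S (Qnt Q y A)"
proof (cases "ys = []")
  case True
  then have "[Q] \<in> S"
    using assms(4) by (auto simp: uniform_words_def continuations_def)
  moreover have "nested_quants A = {}"
    using True assms(2) by (simp add: nested_quants_eq_empty_iff)
  ultimately show ?thesis
    using True assms(1,3) by (auto simp: normal_along_def quant_words_def)
next
  case False
  then have "nested_quants A \<noteq> {}"
    using assms(2) by (simp add: nested_quants_eq_empty_iff)
  then show ?thesis
    using assms(1,3) by (auto simp: normal_along_def quant_words_def continuations_def)
qed

lemma normal_along_connect_all:
  assumes "finite X" "X \<noteq> {}" "c \<in> {Con, Dis}"
    and "\<And>A. A \<in> X \<Longrightarrow> normal_along V ys S A \<and> qrank A = n"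
  shows "normal_along V ys S (connect_all c X) \<and> qrank (connect_all c X) = n"
  using assms(1,2)
  by (induction rule: connect_all_induct)
    (use assms(3,4) in \<open>auto simp: normal_along_Con_iff normal_along_Dis_iff\<close>)

lemma quant_conjuncts_normal_along:
  assumes "B \<in> quant_conjuncts y S X Y" "uniform_words (Suc (length ys)) S" "y \<in> V - set ys"
    and "finite Y" "Y \<noteq> {}"
    and ex: "\<And>A. continuations Ex_Q S \<noteq> {} \<Longrightarrow> A \<in> X \<Longrightarrow>
      normal_along V ys (continuations Ex_Q S) A \<and> qrank A = length ys"
    and all: "\<And>A. continuations All_Q S \<noteq> {} \<Longrightarrow> A \<in> Y \<Longrightarrow>
      normal_along V ys (continuations All_Q S) A \<and> qrank A = length ys"
  shows "normal_along V (y # ys) S B \<and> qrank B = Suc (length ys)"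
proof -
  have Qnt: "normal_along V (y # ys) S (Qnt Q y A) \<and> qrank (Qnt Q y A) = Suc (length ys)"
    if "normal_along V ys (continuations Q S) A \<and> qrank A = length ys" "continuations Q S \<noteq> {}"
    for Q A
    using that(1) normal_along_Qnt[OF _ _ assms(3) uniform_words_continuations[OF assms(2) that(2)]]
    by simp
  consider (Ex) A where "B = Qnt Ex_Q y A" "A \<in> X" "continuations Ex_Q S \<noteq> {}"
    | (All) "B = Qnt All_Q y (connect_all Dis Y)" "continuations All_Q S \<noteq> {}"
    using assms(1) by (auto simp: quant_conjuncts_def split: if_splits)
  then show ?thesis
  proof cases
    case Ex
    then show ?thesis
      using ex Qnt by blast
  next
    case All
    then show ?thesis
      using normal_along_connect_all[OF assms(4,5), of Dis] all Qnt by blast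
  qed
qed

lemma hintikka_fms_normal_along:
  assumes "A \<in> hintikka_fms V ys S" "uniform_words (length ys) S"
    and "finite V" "V \<noteq> {}" "distinct ys" "set ys \<subseteq> V"
  shows "normal_along V ys S A \<and> qrank A = length ys"
  using assms(1,2,5,6)
proof (induction ys arbitrary: S A)
  case Nil
  then obtain T where A_eq: "A = connect_all Con (literals (atoms V) T)"
    by auto
  show ?case
    unfolding A_eq using assms(3,4)
    by (intro normal_along_connect_all)
      (auto simp: literals_def atoms_eq normal_along_def quant_words_def)
next
  case (Cons y ys)
  have uniform: "uniform_words (Suc (length ys)) S"
    using Cons.prems(2) by simp
  obtain X Y where A_eq: "A = connect_all Con (quant_conjuncts y S X Y)"
    and subset_X: "X \<subseteq> hintikka_fms V ys (continuations Ex_Q S)" "X \<noteq> {}"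
    and subset_Y: "Y \<subseteq> hintikka_fms V ys (continuations All_Q S)" "Y \<noteq> {}"
    using Cons.prems(1) by auto
  have finite: "finite X" "finite Y"
    using subset_X(1) subset_Y(1) finite_hintikka_fms[OF assms(3)] by (blast intro: finite_subset)+
  have IH: "normal_along V ys (continuations Q S) B \<and> qrank B = length ys"
    if "continuations Q S \<noteq> {}" "B \<in> hintikka_fms V ys (continuations Q S)" for Q B
    using Cons.IH[OF that(2) uniform_words_continuations[OF uniform that(1)]] Cons.prems(3,4)
    by simp
  have "normal_along V (y # ys) S B \<and> qrank B = Suc (length ys)"
    if "B \<in> quant_conjuncts y S X Y" for B
    using that uniform _ finite(2) subset_Y(2)
  proof (rule quant_conjuncts_normal_along)
    show "y \<in> V - set ys"
      using Cons.prems(3,4) by simp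
  qed (use IH subset_X(1) subset_Y(1) in blast)+
  moreover note quant_conjuncts_finite_nonempty[OF finite(1) subset_X(2) uniform]
  ultimately show ?case
    unfolding A_eq by (intro normal_along_connect_all) simp_all
qed

section \<open>Length of Hintikka formulas\<close>

lemma fm_length_connect_literals:
  assumes "finite V" "V \<noteq> {}"
  shows "fm_length (connect_all Con (literals (atoms V) T)) + 3 \<le> 14 * (card V)\<^sup>2"
proof -
  have "fm_length (connect_all Con (literals (atoms V) T)) + 3 =
      (\<Sum>A\<in>literals (atoms V) T. fm_length A + 3)"
    using finite_atoms[OF assms(1)] atoms_nonempty[OF assms(2)]
    by (intro fm_length_connect_all) (simp_all add: finite_literals literals_eq_empty_iff)
  also have "\<dots> \<le> card (literals (atoms V) T) * 7"
  proof -
    have "fm_length A + 3 \<le> 7" if "A \<in> literals (atoms V) T" for A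
      using that by (auto simp: literals_def atoms_eq)
    then show ?thesis
      using sum_bounded_above[of "literals (atoms V) T" "\<lambda>A. fm_length A + 3" 7] by simp
  qed
  also have "\<dots> \<le> card (atoms V) * 7"
    unfolding literals_def using finite_atoms[OF assms(1)] by (intro mult_le_mono1 card_image_le)
  finally show ?thesis
    by (simp add: card_atoms[OF assms(1)])
qed

lemma fm_length_quant_conjuncts:
  assumes "finite X" "X \<noteq> {}" "finite Y" "Y \<noteq> {}" "card X \<le> t" "card Y \<le> t"
    and "uniform_words (Suc n) S"
    and "\<And>A. continuations Ex_Q S \<noteq> {} \<Longrightarrow> A \<in> X \<Longrightarrow> fm_length A + 5 \<le> t"
    and "\<And>A. continuations All_Q S \<noteq> {} \<Longrightarrow> A \<in> Y \<Longrightarrow> fm_length A + 5 \<le> t"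
  shows "fm_length (connect_all Con (quant_conjuncts y S X Y)) + 3 \<le> 2 * t\<^sup>2"
proof -
  let ?E = "if continuations Ex_Q S = {} then {} else Qnt Ex_Q y ` X"
  let ?U = "if continuations All_Q S = {} then {} else {Qnt All_Q y (connect_all Dis Y)}"
  have mult_le_square: "card Z * t \<le> t\<^sup>2" if "card Z \<le> t" for Z :: "fm set"
    using that by (simp add: power2_eq_square)
  have ex_bound: "(\<Sum>A\<in>?E. fm_length A + 3) \<le> t\<^sup>2"
  proof (cases "continuations Ex_Q S = {}")
    case False
    then have "(\<Sum>A\<in>?E. fm_length A + 3) = (\<Sum>A\<in>X. fm_length A + 5)"
      by (simp add: sum.reindex inj_on_def add.commute)
    also have "\<dots> \<le> card X * t"
      using sum_bounded_above[of X "\<lambda>A. fm_length A + 5" t] assms(8) False by simp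
    finally show ?thesis
      using mult_le_square[OF assms(5)] by linarith
  qed simp
  have all_bound: "(\<Sum>A\<in>?U. fm_length A + 3) \<le> t\<^sup>2"
  proof (cases "continuations All_Q S = {}")
    case False
    then have "fm_length (connect_all Dis Y) + 5 \<le> card Y * t"
      using assms(3,4,9) by (intro fm_length_connect_all_le) simp_all
    then show ?thesis
      using mult_le_square[OF assms(6)] False by simp
  qed simp
  have "fm_length (connect_all Con (quant_conjuncts y S X Y)) + 3 =
      (\<Sum>A\<in>?E \<union> ?U. fm_length A + 3)"
    using fm_length_connect_all[OF quant_conjuncts_finite_nonempty[OF assms(1,2,7)], of Con]
    by (simp add: quant_conjuncts_def)
  also have "\<dots> \<le> (\<Sum>A\<in>?E. fm_length A + 3) + (\<Sum>A\<in>?U. fm_length A + 3)"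
    using assms(1) by (simp add: sum_Un_nat)
  finally show ?thesis
    using ex_bound all_bound by linarith
qed

lemma card_subset_hintikka_fms:
  assumes "finite V" "X \<subseteq> hintikka_fms V ys S"
  shows "card X \<le> hintikka_bound (card V) (length ys)"
  using card_mono[OF finite_hintikka_fms[OF assms(1)] assms(2)] card_hintikka_fms[OF assms(1)]
  by (rule order_trans)

lemma fm_length_hintikka_fms_Cons:
  assumes "A \<in> hintikka_fms V (y # ys) S" "uniform_words (Suc (length ys)) S" "finite V"
    and "\<And>Q B. continuations Q S \<noteq> {} \<Longrightarrow> B \<in> hintikka_fms V ys (continuations Q S) \<Longrightarrow>
      fm_length B + 5 \<le> hintikka_bound (card V) (length ys)"
  shows "fm_length A + 3 \<le> 2 * (hintikka_bound (card V) (length ys))\<^sup>2"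
proof -
  obtain X Y where A_eq: "A = connect_all Con (quant_conjuncts y S X Y)"
    and subset_X: "X \<subseteq> hintikka_fms V ys (continuations Ex_Q S)" "X \<noteq> {}"
    and subset_Y: "Y \<subseteq> hintikka_fms V ys (continuations All_Q S)" "Y \<noteq> {}"
    using assms(1) by auto
  have "finite X" "finite Y"
    using finite_subset[OF _ finite_hintikka_fms[OF assms(3)]] subset_X(1) subset_Y(1) by blast+
  then show ?thesis
    unfolding A_eq using subset_X subset_Y assms(2-4) card_subset_hintikka_fms[OF assms(3)]
    by (intro fm_length_quant_conjuncts) blast+
qed

lemma linear_le_exp: "8 \<le> n \<Longrightarrow> 7 * n + 2 \<le> (2 :: nat) ^ n"
  by (induction n rule: nat_induct_at_least) auto

lemma quadratic_less_exp: "2 \<le> n \<Longrightarrow> 2 * n\<^sup>2 + 3 < (4 :: nat) ^ n"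
proof (induction n rule: nat_induct_at_least)
  case (Suc n)
  have "2 * (Suc n)\<^sup>2 + 3 = 2 * n\<^sup>2 + 4 * n + 5"
    by (simp add: power2_eq_square)
  moreover have "2 * n \<le> n\<^sup>2"
    unfolding power2_eq_square using Suc.hyps by (rule mult_le_mono1)
  ultimately have "2 * (Suc n)\<^sup>2 + 3 \<le> 4 * (2 * n\<^sup>2 + 3)"
    by simp
  also have "\<dots> < 4 ^ Suc n"
    using Suc.IH by simp
  finally show ?case .
qed simp

lemma hintikka_bound_gt_1: "0 < k \<Longrightarrow> 1 < hintikka_bound k n"
  by (induction n) (auto intro!: one_less_power simp del: One_nat_def)

lemma fm_length_hintikka_fms:
  assumes "A \<in> hintikka_fms V ys S" "uniform_words (length ys) S" "finite V" "2 \<le> card V"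
  shows "fm_length A + 5 \<le> hintikka_bound (card V) (length ys)"
  using assms(1,2)
proof (induction ys arbitrary: S A)
  case Nil
  then obtain T where A_eq: "A = connect_all Con (literals (atoms V) T)"
    by auto
  have "V \<noteq> {}"
    using assms(4) by auto
  then have "fm_length A + 5 \<le> 7 * (2 * (card V)\<^sup>2) + 2"
    unfolding A_eq using fm_length_connect_literals[OF assms(3), of T] by simp
  also have "\<dots> \<le> hintikka_bound (card V) (length [])"
    using power_mono[OF assms(4), of 2] linear_le_exp[of "2 * (card V)\<^sup>2"] by simp
  finally show ?case .
next
  case (Cons y ys)
  have uniform: "uniform_words (Suc (length ys)) S"
    using Cons.prems(2) by simp
  have "fm_length A + 3 \<le> 2 * (hintikka_bound (card V) (length ys))\<^sup>2"
    using Cons.prems(1) uniform assms(3)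
    by (rule fm_length_hintikka_fms_Cons)
      (rule Cons.IH[OF _ uniform_words_continuations[OF uniform]])
  also have "\<dots> + 2 \<le> 4 ^ hintikka_bound (card V) (length ys)"
    using quadratic_less_exp[of "hintikka_bound (card V) (length ys)"]
      hintikka_bound_gt_1[of "card V" "length ys"] assms(4) by simp
  finally show ?case
    by simp
qed

section \<open>Towers\<close>

lemma less_tower: "n < tower n"
proof (induction n)
  case (Suc n)
  then show ?case
    using less_exp[of "tower n"] by (simp del: less_exp)
qed simp

lemma le_tower_if_iter_log_le_1: "(log 2 ^^ i) x \<le> 1 \<Longrightarrow> x \<le> real (tower i)"
proof (induction i arbitrary: x)
  case (Suc i)
  then have log_le: "log 2 x \<le> real (tower i)"
    by (simp add: funpow_swap1)
  show ?case
  proof (cases "x > 0")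
    case True
    then have "x \<le> 2 powr real (tower i)"
      using log_le by (simp add: log_le_iff)
    then show ?thesis
      by (simp add: powr_realpow)
  qed (simp add: order_trans[of x 0])
qed simp

lemma ex_iter_log_le_1: "x \<le> real (tower i) \<Longrightarrow> \<exists>j. (log 2 ^^ j) x \<le> 1"
proof (induction i arbitrary: x)
  case 0
  then show ?case by (intro exI[of _ 0]) simp
next
  case (Suc i)
  show ?case
  proof (cases "x \<le> 1")
    case True
    then show ?thesis by (intro exI[of _ 0]) simp
  next
    case False
    then have "log 2 x \<le> real (tower i)"
      using Suc.prems by (simp add: log_le_iff powr_realpow)
    then obtain j where "(log 2 ^^ j) (log 2 x) \<le> 1"
      using Suc.IH by blast
    then show ?thesis
      by (intro exI[of _ "Suc j"]) (simp add: funpow_swap1)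
  qed
qed

lemma le_tower_log_star: "n \<le> tower (log_star n)"
proof -
  have "\<exists>j. (log 2 ^^ j) (real n) \<le> 1"
    using ex_iter_log_le_1[of "real n" n] less_tower[of n] by simp
  then have "(log 2 ^^ log_star n) (real n) \<le> 1"
    unfolding log_star_def by (rule LeastI_ex)
  from le_tower_if_iter_log_le_1[OF this] show ?thesis by simp
qed

lemma quadratic_less_double_exp:
  assumes "2 \<le> k"
  shows "2 * k\<^sup>2 + 3 < (2 :: nat) ^ 2 ^ k"
proof -
  obtain m where "k = Suc m"
    using assms by (cases k) auto
  then have "2 * k \<le> 2 ^ k"
    using less_exp[of m] by (simp add: Suc_leI del: less_exp)
  then have "(4 :: nat) ^ k \<le> 2 ^ 2 ^ k"
    using power_increasing[of "2 * k" "2 ^ k" "2 :: nat"] by (simp add: power_mult)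
  with quadratic_less_exp[OF assms] show ?thesis
    by (rule less_le_trans)
qed

lemma hintikka_bound_Suc_square:
  "2 * (hintikka_bound k (Suc n))\<^sup>2 = 2 ^ (4 * hintikka_bound k n + 1)"
proof -
  have "(4 :: nat) ^ hintikka_bound k n = 2 ^ (2 * hintikka_bound k n)"
    by (simp add: power_mult)
  then show ?thesis
    by (simp flip: power_mult)
qed

lemma hintikka_bound_square_less_tower:
  assumes "2 * k\<^sup>2 + 3 < tower i" "0 < k"
  shows "2 * (hintikka_bound k (Suc n))\<^sup>2 < tower (Suc (Suc (n + i)))"
proof (induction n)
  case 0
  have "4 * hintikka_bound k 0 + 1 \<le> 2 ^ (2 * k\<^sup>2 + 3)"
    by (simp add: power_add)
  also have "\<dots> < 2 ^ tower i"
    using assms(1) by (intro power_strict_increasing) simp_all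
  finally have "(2 :: nat) ^ (4 * hintikka_bound k 0 + 1) < 2 ^ 2 ^ tower i"
    by (rule power_strict_increasing) simp
  then show ?case
    unfolding hintikka_bound_Suc_square by (simp only: add_0 tower.simps)
next
  case (Suc n)
  define t where "t = hintikka_bound k (Suc n)"
  have "1 < hintikka_bound k n"
    using assms(2) by (rule hintikka_bound_gt_1)
  then have "4 ^ 1 \<le> t"
    unfolding t_def hintikka_bound.simps by (intro power_increasing) auto
  then have "4 \<le> t"
    by simp
  then have "4 * t \<le> t\<^sup>2"
    unfolding power2_eq_square by (rule mult_le_mono1)
  then have "4 * t + 1 \<le> 2 * t\<^sup>2"
    using \<open>4 \<le> t\<close> by linarith
  also have "\<dots> < tower (Suc (Suc (n + i)))"
    using Suc.IH by (simp only: t_def)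
  finally have "(2 :: nat) ^ (4 * t + 1) < 2 ^ tower (Suc (Suc (n + i)))"
    by (rule power_strict_increasing) simp
  then show ?case
    unfolding hintikka_bound_Suc_square t_def by (simp only: add_Suc tower.simps)
qed

lemma hintikka_bound_square_less_tower_log_star:
  assumes "2 \<le> k"
  shows "2 * (hintikka_bound k (k - 1))\<^sup>2 < tower (k + log_star k + 2)"
proof -
  obtain n where k_eq: "k = n + 2"
    using assms le_Suc_ex by (metis add.commute)
  have "2 * k\<^sup>2 + 3 < 2 ^ 2 ^ k"
    using assms by (rule quadratic_less_double_exp)
  also have "\<dots> \<le> 2 ^ 2 ^ tower (log_star k)"
    using le_tower_log_star by (intro power_increasing) auto
  finally have "2 * k\<^sup>2 + 3 < tower (log_star k + 2)"
    by simp
  then have "2 * (hintikka_bound k (Suc n))\<^sup>2 < tower (Suc (Suc (n + (log_star k + 2))))"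
    using assms by (intro hintikka_bound_square_less_tower) simp_all
  moreover have "k - 1 = Suc n" "k + log_star k + 2 = Suc (Suc (n + (log_star k + 2)))"
    using k_eq by simp_all
  ultimately show ?thesis
    by (simp only:)
qed

section \<open>Succinct definitions in regular classes\<close>

lemma normal_wrt_0_iff:
  "normal_wrt xs 0 A \<longleftrightarrow>
     normal_along (set xs) xs (quant_words A) A \<and> qrank A = length xs"
  by (auto simp: normal_wrt_def normal_along_def)

lemma normal_sentenceE:
  assumes "normal_fm A" "sentence A" "0 < qrank A"
  obtains xs where "normal_wrt xs 0 A"
proof -
  obtain xs s where "normal_wrt xs s A"
    using assms(1) by (auto simp: normal_fm_def)
  moreover from this have "s = 0"
    using assms(2,3) by (auto simp: normal_wrt_def sentence_def)
  ultimately show thesis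
    using that by simp
qed

lemma uniform_words_quant_words:
  assumes "normal_wrt xs 0 A" "xs \<noteq> []"
  shows "uniform_words (length xs) (quant_words A)"
proof -
  have "length q = length xs" if "q \<in> nested_quants A" for q
    using assms(1) that by (auto simp: normal_wrt_def dest: arg_cong[of _ _ length])
  moreover have "nested_quants A \<noteq> {}"
    using assms by (simp add: nested_quants_eq_empty_iff normal_wrt_def)
  ultimately show ?thesis
    by (auto simp: uniform_words_def quant_words_def)
qed

lemma regular_class_quant_words:
  assumes "regular_class F" "1 \<le> k"
  obtains P where "\<And>A. sentence A \<Longrightarrow> normal_fm A \<Longrightarrow> qrank A = k \<Longrightarrow> A \<in> F \<longleftrightarrow> quant_words A \<subseteq> P"
proof -
  have "\<exists>P \<subseteq> {p. length p = k}. \<forall>A. sentence A \<and> normal_fm A \<and> qrank A = k \<longrightarrow>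
      (A \<in> F \<longleftrightarrow> (\<forall>q \<in> nested_quants A. map fst q \<in> P))"
    using assms by (simp add: regular_class_def)
  then show thesis
    using that by (auto simp: quant_words_def image_subset_iff)
qed

lemma regular_class_quant_words_subset:
  assumes "regular_class F" "B \<in> F" "normal_wrt xs 0 B" "normal_wrt xs 0 C" "xs \<noteq> []"
    and "quant_words C \<subseteq> quant_words B"
  shows "C \<in> F"
proof -
  have "1 \<le> length xs"
    using assms(5) by (simp add: Suc_leI)
  with assms(1) obtain P where P_iff: "\<And>A. sentence A \<Longrightarrow> normal_fm A \<Longrightarrow> qrank A = length xs \<Longrightarrow>
      A \<in> F \<longleftrightarrow> quant_words A \<subseteq> P"
    by (rule regular_class_quant_words) blast
  have "A \<in> F \<longleftrightarrow> quant_words A \<subseteq> P" if "normal_wrt xs 0 A" for A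
  proof (rule P_iff)
    show "normal_fm A"
      using that by (auto simp: normal_fm_def)
  qed (use that in \<open>simp_all add: normal_wrt_def sentence_def\<close>)
  then show ?thesis
    using assms(2-4,6) by blast
qed

text \<open>The valuation is irrelevant, as every variable in \<open>xs\<close> is quantified.\<close>

definition char_sentence :: "var list \<Rightarrow> quant list set \<Rightarrow> 'a pair_pre_digraph \<Rightarrow> fm" where
  "char_sentence xs S G = char_fm (set xs) xs S G undefined"

lemma char_sentence_normal_wrt:
  assumes "pverts G \<noteq> {}" "uniform_words (length xs) S" "distinct xs" "xs \<noteq> []"
  shows "normal_wrt xs 0 (char_sentence xs S G)" "quant_words (char_sentence xs S G) \<subseteq> S"
proof -
  have "char_sentence xs S G \<in> hintikka_fms (set xs) xs S"
    unfolding char_sentence_def using assms(1) by (rule char_fm_in_hintikka_fms)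
  then have "normal_along (set xs) xs S (char_sentence xs S G) \<and>
      qrank (char_sentence xs S G) = length xs"
    using assms by (intro hintikka_fms_normal_along) simp_all
  then show "normal_wrt xs 0 (char_sentence xs S G)" "quant_words (char_sentence xs S G) \<subseteq> S"
    unfolding normal_wrt_0_iff by (auto simp: normal_along_def)
qed

lemma sentence_char_sentence:
  assumes "pverts G \<noteq> {}" "uniform_words (length xs) S" "distinct xs" "xs \<noteq> []"
  shows "sentence (char_sentence xs S G)"
  using char_sentence_normal_wrt(1)[OF assms] by (simp add: normal_wrt_def sentence_def)

lemma true_on_char_sentence_iff:
  assumes "pverts G \<noteq> {}" "uniform_words (length xs) S" "distinct xs" "xs \<noteq> []" "pverts H \<noteq> {}"
  shows "true_on (char_sentence xs S G) H \<longleftrightarrow>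
    duplicator_wins (set xs) xs S G undefined H undefined"
proof -
  have "true_on (char_sentence xs S G) H \<longleftrightarrow> sat H undefined (char_sentence xs S G)"
    using sentence_char_sentence[OF assms(1-4)] assms(5) by (rule true_on_sentence_iff)
  also have "\<dots> \<longleftrightarrow> duplicator_wins (set xs) xs S G undefined H undefined"
    unfolding char_sentence_def
    using assms(1,2,4) by (intro sat_char_fm_iff_duplicator_wins) simp_all
  finally show ?thesis .
qed

lemma fm_length_char_sentence:
  assumes "pverts G \<noteq> {}" "uniform_words (length xs) S" "distinct xs" "2 \<le> length xs"
  shows "fm_length (char_sentence xs S G) \<le> 2 * (hintikka_bound (length xs) (length xs - 1))\<^sup>2"
proof -
  obtain y ys where xs_eq: "xs = y # ys"
    using assms(4) by (cases xs) auto
  have card_xs: "card (set xs) = length xs"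
    using assms(3) by (rule distinct_card)
  have uniform: "uniform_words (Suc (length ys)) S"
    using assms(2) xs_eq by simp
  have "fm_length B + 5 \<le> hintikka_bound (card (set xs)) (length ys)"
    if "continuations Q S \<noteq> {}" "B \<in> hintikka_fms (set xs) ys (continuations Q S)" for Q B
    using that(2) uniform_words_continuations[OF uniform that(1)] _ assms(4)[folded card_xs]
    by (rule fm_length_hintikka_fms) simp
  then have
    "fm_length (char_sentence xs S G) + 3 \<le> 2 * (hintikka_bound (card (set xs)) (length ys))\<^sup>2"
    using char_fm_in_hintikka_fms[OF assms(1), of "set xs" xs S undefined]
    by (intro fm_length_hintikka_fms_Cons[OF _ uniform, of _ "set xs" y])
      (simp_all add: char_sentence_def xs_eq)
  then show ?thesis
    unfolding card_xs by (simp add: xs_eq)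
qed

lemma defines_digraph_char_sentence:
  assumes "defines_digraph B G" "nonempty_digraph G" "normal_wrt xs 0 B" "xs \<noteq> []"
  shows "defines_digraph (char_sentence xs (quant_words B) G) G"
proof (rule defines_digraph_strengthen[OF assms(1)])
  have verts_G: "pverts G \<noteq> {}"
    using assms(2) by (simp add: nonempty_digraph_iff)
  have uniform: "uniform_words (length xs) (quant_words B)"
    using assms(3,4) by (rule uniform_words_quant_words)
  have "distinct xs"
    using assms(3) by (simp add: normal_wrt_def)
  note char_sentence_iff = true_on_char_sentence_iff[OF verts_G uniform this assms(4)]
  show "sentence (char_sentence xs (quant_words B) G)"
    using verts_G uniform \<open>distinct xs\<close> assms(4) by (rule sentence_char_sentence)
  show "true_on (char_sentence xs (quant_words B) G) G"
    unfolding char_sentence_iff[OF verts_G] by (rule duplicator_wins_refl) simp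
  have true_B: "sentence B" "true_on B G"
    using assms(1) by (simp_all add: defines_digraph_def)
  fix H :: "nat pair_pre_digraph"
  assume "nonempty_digraph H" and true_H: "true_on (char_sentence xs (quant_words B) G) H"
  then have verts_H: "pverts H \<noteq> {}"
    by (simp add: nonempty_digraph_iff)
  have "sat H undefined B"
  proof (rule duplicator_wins_transfer[OF _ uniform verts_G verts_H])
    show "duplicator_wins (set xs) xs (quant_words B) G undefined H undefined"
      using true_H unfolding char_sentence_iff[OF verts_H] .
    show "normal_along (set xs) xs (quant_words B) B"
      using assms(3) by (simp add: normal_wrt_0_iff)
    show "sat G undefined B"
      using true_B(2) true_on_sentence_iff[OF true_B(1) verts_G] by blast
  qed
  then show "true_on B H"
    using true_on_sentence_iff[OF true_B(1) verts_H] by blast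
qed

lemma regular_class_short_definition:
  assumes "regular_class F" "nonempty_digraph G" "A \<in> F" "defines_digraph A G"
  obtains C where "C \<in> F" "defines_digraph C G"
    "fm_length C \<le> 2 * (hintikka_bound (qrank A) (qrank A - 1))\<^sup>2"
proof -
  obtain B where normal_form: "B \<in> F" "normal_form_of B A"
    using assms(1,3) unfolding regular_class_def by blast
  have def_B: "defines_digraph B G"
    using assms(4) normal_form(2) assms(2) by (rule defines_digraph_normal_form)
  have rank: "qrank B = qrank A" "2 \<le> qrank A"
    using normal_form(2) defines_digraph_qrank_ge_2[OF assms(4,2)]
    by (simp_all add: normal_form_of_def)
  obtain xs where normal_B: "normal_wrt xs 0 B"
    using normal_sentenceE[of B] normal_form(2) def_B rank
    by (auto simp: normal_form_of_def defines_digraph_def)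
  then have xs_props: "length xs = qrank A" "distinct xs"
    using rank(1) by (simp_all add: normal_wrt_def)
  then have nonempty: "xs \<noteq> []"
    using rank(2) by auto
  have verts_G: "pverts G \<noteq> {}"
    using assms(2) by (simp add: nonempty_digraph_iff)
  note uniform = uniform_words_quant_words[OF normal_B nonempty]
  let ?C = "char_sentence xs (quant_words B) G"
  note normal_C = char_sentence_normal_wrt[OF verts_G uniform xs_props(2) nonempty]
  show thesis
  proof (rule that)
    show "?C \<in> F"
      using assms(1) normal_form(1) normal_B normal_C(1) nonempty normal_C(2)
      by (rule regular_class_quant_words_subset)
    show "defines_digraph ?C G"
      using def_B assms(2) normal_B nonempty by (rule defines_digraph_char_sentence)
    show "fm_length ?C \<le> 2 * (hintikka_bound (qrank A) (qrank A - 1))\<^sup>2"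
      using fm_length_char_sentence[OF verts_G uniform xs_props(2)] xs_props(1) rank(2) by simp
  qed
qed

lemma def_qrank_attained:
  assumes "definable_in F G"
  obtains A where "A \<in> F" "defines_digraph A G" "qrank A = def_qrank F G"
proof -
  have "\<exists>d. \<exists>A\<in>F. defines_digraph A G \<and> qrank A = d"
    using assms by (auto simp: definable_in_def)
  from LeastI_ex[OF this] show thesis
    using that by (auto simp: def_qrank_def)
qed

lemma def_length_le: "A \<in> F \<Longrightarrow> defines_digraph A G \<Longrightarrow> def_length F G \<le> fm_length A"
  unfolding def_length_def by (intro Least_le) blast

theorem theorem8:
  fixes F :: "fm set" and G :: "'a pair_pre_digraph"
  assumes "regular_class F"
    and "nonempty_digraph G"
    and "definable_in F G"
  shows "def_length F G < tower (def_qrank F G + log_star (def_qrank F G) + 2)"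
proof -
  let ?k = "def_qrank F G"
  obtain A where min_rank: "A \<in> F" "defines_digraph A G" "qrank A = ?k"
    using assms(3) by (rule def_qrank_attained)
  obtain C where short: "C \<in> F" "defines_digraph C G"
    "fm_length C \<le> 2 * (hintikka_bound ?k (?k - 1))\<^sup>2"
    using regular_class_short_definition[OF assms(1,2) min_rank(1,2)] min_rank(3) by metis
  have "def_length F G \<le> fm_length C"
    using short(1,2) by (rule def_length_le)
  also note short(3)
  also have "2 * (hintikka_bound ?k (?k - 1))\<^sup>2 < tower (?k + log_star ?k + 2)"
    using defines_digraph_qrank_ge_2[OF min_rank(2) assms(2)] min_rank(3)
    by (intro hintikka_bound_square_less_tower_log_star) simp
  finally show ?thesis .
qed

end
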